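(* Let $R$ be a finite commutative chain ring with maximal ideal $N=\langle a\rangle$, $a\in R$, let $k$ be the nilpotency index of $a$, let $\mathbb{F}=R/\langle a\rangle$ be the residue field and $p$ its characteristic, and let $G$ be a commutative group. Then $$E(RG)=\left\{f^{r} : r=p^{k-1},\ f\in RG \text{ and } \bar{f}\in E(\mathbb{F}G)\right\}.$$
   Context: For a commutative ring $A$, $E(A)=\{e\in A : e^2=e\}$ denotes its set of idempotent elements. A finite commutative chain ring is a finite commutative ring with identity whose ideals are totally ordered by inclusion; it has a unique maximal ideal, which is principal and nilpotent. The nilpotency index of $a$ is the least positive integer $k$ with $a^k=0$. $RG$ denotes the group ring of $G$ over $R$, and for $f\in RG$, $\bar f\in\mathbb{F}G$ denotes the element obtained by reducing the coefficients of $f$ modulo $\langle a\rangle$. *)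

theory Defs
  imports "HOL-Algebra.QuotRing"
begin

text \<open>The zero ring is excluded, so that a chain ring has exactly one maximal ideal.\<close>

locale finite_chain_ring = cring R for R (structure) +
  assumes finite_carrier: "finite (carrier R)"
    and one_neq_zero: "\<one> \<noteq> \<zero>"
    and ideals_chain: "\<lbrakk>ideal I R; ideal J R\<rbrakk> \<Longrightarrow> I \<subseteq> J \<or> J \<subseteq> I"

definition nilpotency_index :: "('a, 'm) ring_scheme \<Rightarrow> 'a \<Rightarrow> nat" where
  "nilpotency_index R a = (LEAST k. 0 < k \<and> a [^]\<^bsub>R\<^esub> k = \<zero>\<^bsub>R\<^esub>)"

definition ring_characteristic :: "('a, 'm) ring_scheme \<Rightarrow> nat" where
  "ring_characteristic R =
     (if \<exists>n>(0::nat). add_pow R n \<one>\<^bsub>R\<^esub> = \<zero>\<^bsub>R\<^esub>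
      then LEAST n::nat. 0 < n \<and> add_pow R n \<one>\<^bsub>R\<^esub> = \<zero>\<^bsub>R\<^esub> else 0)"

definition idempotents :: "('a, 'm) ring_scheme \<Rightarrow> 'a set" where
  "idempotents A = {e \<in> carrier A. e [^]\<^bsub>A\<^esub> (2::nat) = e}"

text \<open>
  An element $\sum_{x \in G} f_x\, x$ of the group ring is represented by its coefficient
  function, which is extensional (\<^const>\<open>undefined\<close> outside the carrier of the group), so that
  equality of elements is equality of functions.  The group is written multiplicatively and may
  be infinite; only the supports are required to be finite.
\<close>

definition group_ring_support ::
    "('a, 'm) ring_scheme \<Rightarrow> ('g, 'n) monoid_scheme \<Rightarrow> ('g \<Rightarrow> 'a) \<Rightarrow> 'g set" where
  "group_ring_support R G f = {x \<in> carrier G. f x \<noteq> \<zero>\<^bsub>R\<^esub>}"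

definition group_ring ::
    "('a, 'm) ring_scheme \<Rightarrow> ('g, 'n) monoid_scheme \<Rightarrow> ('g \<Rightarrow> 'a) ring" where
  "group_ring R G =
    \<lparr> carrier = {f \<in> carrier G \<rightarrow>\<^sub>E carrier R. finite (group_ring_support R G f)},
      mult = (\<lambda>f g. \<lambda>x\<in>carrier G.
        \<Oplus>\<^bsub>R\<^esub>y\<in>group_ring_support R G f. f y \<otimes>\<^bsub>R\<^esub> g (inv\<^bsub>G\<^esub> y \<otimes>\<^bsub>G\<^esub> x)),
      one = (\<lambda>x\<in>carrier G. if x = \<one>\<^bsub>G\<^esub> then \<one>\<^bsub>R\<^esub> else \<zero>\<^bsub>R\<^esub>),
      zero = (\<lambda>x\<in>carrier G. \<zero>\<^bsub>R\<^esub>),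
      add = (\<lambda>f g. \<lambda>x\<in>carrier G. f x \<oplus>\<^bsub>R\<^esub> g x) \<rparr>"

definition reduce_coeffs ::
    "('a, 'm) ring_scheme \<Rightarrow> 'a set \<Rightarrow> ('g, 'n) monoid_scheme \<Rightarrow> ('g \<Rightarrow> 'a) \<Rightarrow> ('g \<Rightarrow> 'a set)" where
  "reduce_coeffs R I G f = (\<lambda>x\<in>carrier G. I +>\<^bsub>R\<^esub> f x)"

end

theory Submission
  imports Defs
begin

text \<open>
  If $e$ is idempotent then $e^r = e$ for every $r > 0$, and reduction of coefficients is
  multiplicative, so $\bar e$ is idempotent: every idempotent of $RG$ is of the required form.

  Conversely, $\bar f^2 = \bar f$ says that $f^2 = f + a h$ for some $h \in RG$.
  A congruence modulo $a^i$ with $i \ge 1$ becomes one modulo $a^{i+1}$ on raising both sides to the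
  $p$-th power, because $p \in \langle a \rangle$
  (\<open>pow_cong_step\<close>). After $k - 1$ such steps (\<open>pow_cong_iterate\<close>) the two sides agree modulo
  $a^k = 0$, hence $(f^2)^r = f^r$ for $r = p^{k-1}$, which is idempotence of $f^r$.
  That $p$ is positive and lies in $\langle a \rangle$ comes from finiteness of $R$
  (\<open>residue_characteristic\<close>). The chain condition enters through the
  nilpotency of $a$ (\<open>maximal_generator_nilpotent\<close>), which ensures that the least exponent $k$
  really satisfies $a^k = 0$.

  The power computations take place in the ring $RG$ itself, with $a$ replaced by the constant
  $a \cdot 1_G$. That $RG$ is a commutative ring is proved from the convolution formula
  (\<open>group_ring_cring\<close>).
\<close>

section \<open>The group ring as a commutative ring\<close>

lemma (in abelian_monoid) finsum_swap:
  assumes "finite A" "finite B" "\<And>x y. \<lbrakk>x \<in> A; y \<in> B\<rbrakk> \<Longrightarrow> f x y \<in> carrier G"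
  shows "(\<Oplus>x\<in>A. \<Oplus>y\<in>B. f x y) = (\<Oplus>y\<in>B. \<Oplus>x\<in>A. f x y)"
  using assms(1,3)
proof (induction A)
  case empty
  then show ?case by (simp add: finsum_zero)
next
  case (insert a A)
  have "(\<Oplus>x\<in>insert a A. \<Oplus>y\<in>B. f x y) = (\<Oplus>y\<in>B. f a y) \<oplus> (\<Oplus>x\<in>A. \<Oplus>y\<in>B. f x y)"
    using insert by (subst finsum_insert) (auto intro!: finsum_closed)
  also have "\<dots> = (\<Oplus>y\<in>B. f a y) \<oplus> (\<Oplus>y\<in>B. \<Oplus>x\<in>A. f x y)"
    using insert by simp
  also have "\<dots> = (\<Oplus>y\<in>B. f a y \<oplus> (\<Oplus>x\<in>A. f x y))"
    using insert by (subst finsum_addf) (auto intro!: finsum_closed)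
  also have "\<dots> = (\<Oplus>y\<in>B. \<Oplus>x\<in>insert a A. f x y)"
    using insert by (intro finsum_cong') (auto intro!: finsum_closed)
  finally show ?case .
qed

locale comm_group_ring = R: cring R + G: comm_group G
  for R :: "('a, 'm) ring_scheme" (structure) and G :: "('g, 'n) monoid_scheme" (structure)
begin

abbreviation RG :: "('g \<Rightarrow> 'a) ring" where
  "RG \<equiv> group_ring R G"

abbreviation supp :: "('g \<Rightarrow> 'a) \<Rightarrow> 'g set" where
  "supp \<equiv> group_ring_support R G"

lemma coeff_closed: "\<lbrakk>f \<in> carrier RG; x \<in> carrier G\<rbrakk> \<Longrightarrow> f x \<in> carrier R"
  by (auto simp: group_ring_def)

lemma finite_supp: "f \<in> carrier RG \<Longrightarrow> finite (supp f)"
  by (simp add: group_ring_def)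

lemma supp_subset: "supp f \<subseteq> carrier G"
  by (auto simp: group_ring_support_def)

lemma mem_supp: "x \<in> supp f \<longleftrightarrow> x \<in> carrier G \<and> f x \<noteq> \<zero>"
  by (simp add: group_ring_support_def)

lemma group_ring_memI:
  assumes "\<And>x. x \<in> carrier G \<Longrightarrow> f x \<in> carrier R"
    and "\<And>x. x \<in> carrier G \<Longrightarrow> f x \<noteq> \<zero> \<Longrightarrow> x \<in> S" and "finite S"
  shows "restrict f (carrier G) \<in> carrier RG"
  using assms by (auto simp: group_ring_def group_ring_support_def intro: finite_subset[of _ S])

lemma group_ring_eqI:
  assumes "f \<in> carrier RG" "g \<in> carrier RG" "\<And>x. x \<in> carrier G \<Longrightarrow> f x = g x"
  shows "f = g"
proof (rule PiE_ext)
  show "f \<in> carrier G \<rightarrow>\<^sub>E carrier R" "g \<in> carrier G \<rightarrow>\<^sub>E carrier R"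
    using assms(1,2) by (simp_all add: group_ring_def)
qed (rule assms(3))

lemma add_coeff: "x \<in> carrier G \<Longrightarrow> (f \<oplus>\<^bsub>RG\<^esub> g) x = f x \<oplus> g x"
  by (simp add: group_ring_def)

lemma zero_coeff: "x \<in> carrier G \<Longrightarrow> \<zero>\<^bsub>RG\<^esub> x = \<zero>"
  by (simp add: group_ring_def)

lemma add_closed:
  assumes "f \<in> carrier RG" "g \<in> carrier RG"
  shows "f \<oplus>\<^bsub>RG\<^esub> g \<in> carrier RG"
proof -
  have "(\<lambda>x\<in>carrier G. f x \<oplus> g x) \<in> carrier RG"
    using assms by (intro group_ring_memI[where S = "supp f \<union> supp g"])
      (auto simp: mem_supp coeff_closed finite_supp)
  then show ?thesis by (simp add: group_ring_def)
qed

lemma one_closed: "\<one>\<^bsub>RG\<^esub> \<in> carrier RG"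
proof -
  have "(\<lambda>x\<in>carrier G. if x = \<one>\<^bsub>G\<^esub> then \<one> else \<zero>) \<in> carrier RG"
    by (intro group_ring_memI[where S = "{\<one>\<^bsub>G\<^esub>}"]) (auto split: if_splits)
  then show ?thesis by (simp add: group_ring_def)
qed

lemma zero_closed: "\<zero>\<^bsub>RG\<^esub> \<in> carrier RG"
proof -
  have "(\<lambda>x\<in>carrier G. \<zero>) \<in> carrier RG"
    by (intro group_ring_memI[where S = "{}"]) auto
  then show ?thesis by (simp add: group_ring_def)
qed

lemma mult_coeff_supp:
  "x \<in> carrier G \<Longrightarrow>
    (f \<otimes>\<^bsub>RG\<^esub> g) x = (\<Oplus>y\<in>supp f. f y \<otimes> g (inv\<^bsub>G\<^esub> y \<otimes>\<^bsub>G\<^esub> x))"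
  by (simp add: group_ring_def)

lemma group_ring_mult_restrict:
  "f \<otimes>\<^bsub>RG\<^esub> g = restrict (f \<otimes>\<^bsub>RG\<^esub> g) (carrier G)"
  by (simp add: group_ring_def fun_eq_iff)

definition const :: "'a \<Rightarrow> 'g \<Rightarrow> 'a" where
  "const c = (\<lambda>x\<in>carrier G. if x = \<one>\<^bsub>G\<^esub> then c else \<zero>)"

lemma const_closed:
  assumes "c \<in> carrier R"
  shows "const c \<in> carrier RG"
  unfolding const_def using assms
  by (intro group_ring_memI[where S = "{\<one>\<^bsub>G\<^esub>}"]) (auto split: if_splits)

lemma const_one: "const \<one> = \<one>\<^bsub>RG\<^esub>"
  by (simp add: const_def group_ring_def)

text \<open>
  Under \<open>group_ring_def\<close> the premise \<open>f \<in> carrier RG\<close> unfolds to an instance of the conclusion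
  of either fact, so they serve as simplification rules only where that definition stays folded.
\<close>

declare coeff_closed [simp] finite_supp [simp]

text \<open>
  The convolution sum runs over the support of the left factor only. Comparing products of
  different elements needs a common index set, so any finite superset is admitted.
\<close>

lemma mult_coeff:
  assumes "f \<in> carrier RG" "g \<in> carrier RG" "x \<in> carrier G"
    and "finite S" "supp f \<subseteq> S" "S \<subseteq> carrier G"
  shows "(f \<otimes>\<^bsub>RG\<^esub> g) x = (\<Oplus>y\<in>S. f y \<otimes> g (inv\<^bsub>G\<^esub> y \<otimes>\<^bsub>G\<^esub> x))"
proof -
  have "(f \<otimes>\<^bsub>RG\<^esub> g) x = (\<Oplus>y\<in>supp f. f y \<otimes> g (inv\<^bsub>G\<^esub> y \<otimes>\<^bsub>G\<^esub> x))"
    using assms(3) by (rule mult_coeff_supp)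
  also have "\<dots> = (\<Oplus>y\<in>S. f y \<otimes> g (inv\<^bsub>G\<^esub> y \<otimes>\<^bsub>G\<^esub> x))"
    using assms
    by (intro R.add.finprod_mono_neutral_cong_left) (auto simp: mem_supp subset_iff)
  finally show ?thesis .
qed

lemma mult_supp:
  assumes "f \<in> carrier RG" "g \<in> carrier RG"
  shows "supp (f \<otimes>\<^bsub>RG\<^esub> g) \<subseteq> (\<lambda>(y, z). y \<otimes>\<^bsub>G\<^esub> z) ` (supp f \<times> supp g)"
proof
  fix x assume "x \<in> supp (f \<otimes>\<^bsub>RG\<^esub> g)"
  then have x: "x \<in> carrier G" and "(\<Oplus>y\<in>supp f. f y \<otimes> g (inv\<^bsub>G\<^esub> y \<otimes>\<^bsub>G\<^esub> x)) \<noteq> \<zero>"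
    using mult_coeff_supp by (auto simp: mem_supp)
  then obtain y where y: "y \<in> supp f" and "f y \<otimes> g (inv\<^bsub>G\<^esub> y \<otimes>\<^bsub>G\<^esub> x) \<noteq> \<zero>"
    using R.add.finprod_one_eqI[of "supp f" "\<lambda>y. f y \<otimes> g (inv\<^bsub>G\<^esub> y \<otimes>\<^bsub>G\<^esub> x)"] by metis
  then have "inv\<^bsub>G\<^esub> y \<otimes>\<^bsub>G\<^esub> x \<in> supp g"
    using assms x by (auto simp: mem_supp)
  moreover have "x = y \<otimes>\<^bsub>G\<^esub> (inv\<^bsub>G\<^esub> y \<otimes>\<^bsub>G\<^esub> x)"
    using x y supp_subset[of f] by (auto simp: G.m_assoc[symmetric])
  ultimately show "x \<in> (\<lambda>(y, z). y \<otimes>\<^bsub>G\<^esub> z) ` (supp f \<times> supp g)"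
    using y by (intro image_eqI[of _ _ "(y, inv\<^bsub>G\<^esub> y \<otimes>\<^bsub>G\<^esub> x)"]) auto
qed

lemma mult_closed:
  assumes "f \<in> carrier RG" "g \<in> carrier RG"
  shows "f \<otimes>\<^bsub>RG\<^esub> g \<in> carrier RG"
proof (subst group_ring_mult_restrict, rule group_ring_memI)
  show "finite (supp (f \<otimes>\<^bsub>RG\<^esub> g))"
    using assms by (auto intro: finite_subset[OF mult_supp])
  fix x assume x: "x \<in> carrier G"
  show "(f \<otimes>\<^bsub>RG\<^esub> g) x \<in> carrier R"
    using assms x subsetD[OF supp_subset] by (auto simp: mult_coeff_supp intro!: R.finsum_closed)
  show "(f \<otimes>\<^bsub>RG\<^esub> g) x \<noteq> \<zero> \<Longrightarrow> x \<in> supp (f \<otimes>\<^bsub>RG\<^esub> g)"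
    using x by (simp add: mem_supp)
qed

text \<open>
  The involution $y \mapsto y^{-1} x$ exchanges the two arguments in the $x$-coefficient of the
  product.
\<close>

lemma mult_comm:
  assumes f: "f \<in> carrier RG" and g: "g \<in> carrier RG"
  shows "f \<otimes>\<^bsub>RG\<^esub> g = g \<otimes>\<^bsub>RG\<^esub> f"
proof (rule group_ring_eqI)
  fix x assume x: "x \<in> carrier G"
  define h where "h y = inv\<^bsub>G\<^esub> y \<otimes>\<^bsub>G\<^esub> x" for y
  have h_closed: "h y \<in> carrier G" if "y \<in> carrier G" for y
    using that x by (simp add: h_def)
  have hh: "h (h y) = y" if "y \<in> carrier G" for y
  proof -
    have "h (h y) = inv\<^bsub>G\<^esub> x \<otimes>\<^bsub>G\<^esub> (y \<otimes>\<^bsub>G\<^esub> x)"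
      using that x by (simp add: h_def G.inv_mult_group G.m_assoc)
    also have "\<dots> = inv\<^bsub>G\<^esub> x \<otimes>\<^bsub>G\<^esub> (x \<otimes>\<^bsub>G\<^esub> y)"
      using that x by (simp add: G.m_comm)
    also have "\<dots> = y"
      using that x by (simp add: G.m_assoc[symmetric])
    finally show ?thesis .
  qed
  \<comment> \<open>Enlarged so that the image under the involution contains the support of the other factor.\<close>
  define S where "S = supp f \<union> h ` supp g"
  have S: "finite S" "S \<subseteq> carrier G"
    using f g supp_subset h_closed by (auto simp: S_def)
  have "h ` h ` supp g = (\<lambda>y. y) ` supp g"
    unfolding image_image using hh supp_subset by (intro image_cong refl) blast
  then have "h ` S = supp g \<union> h ` supp f"
    by (simp add: S_def image_Un Un_commute)
  then have hS': "supp g \<subseteq> h ` S"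
    by blast
  have "(f \<otimes>\<^bsub>RG\<^esub> g) x = (\<Oplus>y\<in>S. f y \<otimes> g (h y))"
    using S f g x unfolding h_def by (intro mult_coeff) (auto simp: S_def)
  also have "\<dots> = (\<Oplus>y\<in>S. g (h y) \<otimes> f (h (h y)))"
    using f g S hh h_closed by (intro R.finsum_cong') (auto simp: R.m_comm subset_iff)
  also have "\<dots> = (\<Oplus>z\<in>h ` S. g z \<otimes> f (h z))"
    using f g S hh h_closed
    by (intro R.finsum_reindex[symmetric]) (auto simp: subset_iff intro: inj_on_inverseI[of _ h])
  also have "\<dots> = (g \<otimes>\<^bsub>RG\<^esub> f) x"
    unfolding h_def using S h_closed hS'
    by (intro mult_coeff[OF g f x, symmetric]) (auto simp: h_def)
  finally show "(f \<otimes>\<^bsub>RG\<^esub> g) x = (g \<otimes>\<^bsub>RG\<^esub> f) x" .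
qed (use assms in \<open>auto intro: mult_closed\<close>)

text \<open>
  Both bracketings become a double sum over $z$ in the support of $f$ and $y$ in the product of the
  supports of $f$ and $g$; for fixed $z$ the substitution $y = z w$ turns the inner sum into a
  coefficient of $g h$.
\<close>

lemma mult_assoc:
  assumes f: "f \<in> carrier RG" and g: "g \<in> carrier RG" and h: "h \<in> carrier RG"
  shows "(f \<otimes>\<^bsub>RG\<^esub> g) \<otimes>\<^bsub>RG\<^esub> h = f \<otimes>\<^bsub>RG\<^esub> (g \<otimes>\<^bsub>RG\<^esub> h)"
proof (rule group_ring_eqI)
  fix x assume x: "x \<in> carrier G"
  define T where "T = (\<lambda>(y, z). y \<otimes>\<^bsub>G\<^esub> z) ` (supp f \<times> supp g)"
  have T: "finite T" "T \<subseteq> carrier G"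
    using f g supp_subset by (auto simp: T_def)
  note [simp] = subsetD[OF T(2)] subsetD[OF supp_subset]
  have inner: "(\<Oplus>y\<in>T. g (inv\<^bsub>G\<^esub> z \<otimes>\<^bsub>G\<^esub> y) \<otimes> h (inv\<^bsub>G\<^esub> y \<otimes>\<^bsub>G\<^esub> x)) = (g \<otimes>\<^bsub>RG\<^esub> h) (inv\<^bsub>G\<^esub> z \<otimes>\<^bsub>G\<^esub> x)"
    if z: "z \<in> supp f" for z
  proof -
    define S where "S = (\<lambda>y. inv\<^bsub>G\<^esub> z \<otimes>\<^bsub>G\<^esub> y) ` T"
    have "supp g \<subseteq> S"
    proof
      fix w assume w: "w \<in> supp g"
      then have "w = inv\<^bsub>G\<^esub> z \<otimes>\<^bsub>G\<^esub> (z \<otimes>\<^bsub>G\<^esub> w)" "z \<otimes>\<^bsub>G\<^esub> w \<in> T"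
        using z by (auto simp: G.m_assoc[symmetric] T_def)
      then show "w \<in> S" by (auto simp: S_def)
    qed
    moreover have "finite S" "S \<subseteq> carrier G"
      using T z by (auto simp: S_def)
    ultimately have "(g \<otimes>\<^bsub>RG\<^esub> h) (inv\<^bsub>G\<^esub> z \<otimes>\<^bsub>G\<^esub> x) =
        (\<Oplus>w\<in>S. g w \<otimes> h (inv\<^bsub>G\<^esub> w \<otimes>\<^bsub>G\<^esub> (inv\<^bsub>G\<^esub> z \<otimes>\<^bsub>G\<^esub> x)))"
      using g h x z by (intro mult_coeff) auto
    also have "\<dots> = (\<Oplus>y\<in>T. g (inv\<^bsub>G\<^esub> z \<otimes>\<^bsub>G\<^esub> y) \<otimes>
        h (inv\<^bsub>G\<^esub> (inv\<^bsub>G\<^esub> z \<otimes>\<^bsub>G\<^esub> y) \<otimes>\<^bsub>G\<^esub> (inv\<^bsub>G\<^esub> z \<otimes>\<^bsub>G\<^esub> x)))"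
      unfolding S_def using g h x z by (intro R.finsum_reindex) (auto simp: inj_on_def)
    also have "\<dots> = (\<Oplus>y\<in>T. g (inv\<^bsub>G\<^esub> z \<otimes>\<^bsub>G\<^esub> y) \<otimes> h (inv\<^bsub>G\<^esub> y \<otimes>\<^bsub>G\<^esub> x))"
    proof (intro R.finsum_cong' refl)
      fix y assume y: "y \<in> T"
      have "inv\<^bsub>G\<^esub> (inv\<^bsub>G\<^esub> z \<otimes>\<^bsub>G\<^esub> y) \<otimes>\<^bsub>G\<^esub> (inv\<^bsub>G\<^esub> z \<otimes>\<^bsub>G\<^esub> x) = inv\<^bsub>G\<^esub> y \<otimes>\<^bsub>G\<^esub> (z \<otimes>\<^bsub>G\<^esub> (inv\<^bsub>G\<^esub> z \<otimes>\<^bsub>G\<^esub> x))"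
        using y x z by (simp add: G.inv_mult_group G.m_assoc)
      also have "\<dots> = inv\<^bsub>G\<^esub> y \<otimes>\<^bsub>G\<^esub> x"
        using y x z by (simp add: G.m_assoc[symmetric])
      finally show "g (inv\<^bsub>G\<^esub> z \<otimes>\<^bsub>G\<^esub> y) \<otimes> h (inv\<^bsub>G\<^esub> (inv\<^bsub>G\<^esub> z \<otimes>\<^bsub>G\<^esub> y) \<otimes>\<^bsub>G\<^esub> (inv\<^bsub>G\<^esub> z \<otimes>\<^bsub>G\<^esub> x)) =
          g (inv\<^bsub>G\<^esub> z \<otimes>\<^bsub>G\<^esub> y) \<otimes> h (inv\<^bsub>G\<^esub> y \<otimes>\<^bsub>G\<^esub> x)" by simp
    qed (use g h x z in auto)
    finally show ?thesis by simp
  qed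
  have "((f \<otimes>\<^bsub>RG\<^esub> g) \<otimes>\<^bsub>RG\<^esub> h) x = (\<Oplus>y\<in>T. (f \<otimes>\<^bsub>RG\<^esub> g) y \<otimes> h (inv\<^bsub>G\<^esub> y \<otimes>\<^bsub>G\<^esub> x))"
    using T f g h x mult_supp[OF f g] by (intro mult_coeff mult_closed) (auto simp: T_def)
  also have "\<dots> = (\<Oplus>y\<in>T. \<Oplus>z\<in>supp f. f z \<otimes> g (inv\<^bsub>G\<^esub> z \<otimes>\<^bsub>G\<^esub> y) \<otimes> h (inv\<^bsub>G\<^esub> y \<otimes>\<^bsub>G\<^esub> x))"
    using f g h x
    by (intro R.finsum_cong' refl)
      (auto intro!: R.finsum_closed simp: mult_coeff[OF f g _ finite_supp[OF f] subset_refl supp_subset] R.finsum_ldistr)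
  also have "\<dots> = (\<Oplus>z\<in>supp f. \<Oplus>y\<in>T. f z \<otimes> g (inv\<^bsub>G\<^esub> z \<otimes>\<^bsub>G\<^esub> y) \<otimes> h (inv\<^bsub>G\<^esub> y \<otimes>\<^bsub>G\<^esub> x))"
    using T f g h x by (intro R.finsum_swap) auto
  also have "\<dots> = (\<Oplus>z\<in>supp f. f z \<otimes> (g \<otimes>\<^bsub>RG\<^esub> h) (inv\<^bsub>G\<^esub> z \<otimes>\<^bsub>G\<^esub> x))"
  proof (intro R.finsum_cong' refl)
    fix z assume z: "z \<in> supp f"
    have "(\<Oplus>y\<in>T. f z \<otimes> g (inv\<^bsub>G\<^esub> z \<otimes>\<^bsub>G\<^esub> y) \<otimes> h (inv\<^bsub>G\<^esub> y \<otimes>\<^bsub>G\<^esub> x)) =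
        (\<Oplus>y\<in>T. f z \<otimes> (g (inv\<^bsub>G\<^esub> z \<otimes>\<^bsub>G\<^esub> y) \<otimes> h (inv\<^bsub>G\<^esub> y \<otimes>\<^bsub>G\<^esub> x)))"
      using f g h x z by (intro R.finsum_cong' refl) (auto simp: R.m_assoc)
    also have "\<dots> = f z \<otimes> (g \<otimes>\<^bsub>RG\<^esub> h) (inv\<^bsub>G\<^esub> z \<otimes>\<^bsub>G\<^esub> x)"
      using T f g h x z by (subst inner[symmetric]) (auto simp: R.finsum_rdistr)
    finally show "(\<Oplus>y\<in>T. f z \<otimes> g (inv\<^bsub>G\<^esub> z \<otimes>\<^bsub>G\<^esub> y) \<otimes> h (inv\<^bsub>G\<^esub> y \<otimes>\<^bsub>G\<^esub> x)) =
        f z \<otimes> (g \<otimes>\<^bsub>RG\<^esub> h) (inv\<^bsub>G\<^esub> z \<otimes>\<^bsub>G\<^esub> x)" .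
  qed (use f g h x in \<open>auto simp: mult_closed\<close>)
  also have "\<dots> = (f \<otimes>\<^bsub>RG\<^esub> (g \<otimes>\<^bsub>RG\<^esub> h)) x"
    using f g h x by (intro mult_coeff[symmetric] mult_closed) (auto simp: supp_subset)
  finally show "((f \<otimes>\<^bsub>RG\<^esub> g) \<otimes>\<^bsub>RG\<^esub> h) x = (f \<otimes>\<^bsub>RG\<^esub> (g \<otimes>\<^bsub>RG\<^esub> h)) x" .
qed (use assms in \<open>auto intro: mult_closed\<close>)

lemma const_mult_coeff:
  assumes "c \<in> carrier R" "f \<in> carrier RG" "x \<in> carrier G"
  shows "(const c \<otimes>\<^bsub>RG\<^esub> f) x = c \<otimes> f x"
proof -
  have "(const c \<otimes>\<^bsub>RG\<^esub> f) x = (\<Oplus>y\<in>{\<one>\<^bsub>G\<^esub>}. const c y \<otimes> f (inv\<^bsub>G\<^esub> y \<otimes>\<^bsub>G\<^esub> x))"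
    using assms by (intro mult_coeff const_closed) (auto simp: mem_supp const_def split: if_splits)
  also have "\<dots> = c \<otimes> f x"
    using assms by (simp add: const_def)
  finally show ?thesis .
qed

lemma group_ring_cring: "cring RG"
proof (rule cringI)
  show "abelian_group RG"
  proof (rule abelian_groupI)
    fix f assume f: "f \<in> carrier RG"
    have m: "(\<lambda>x\<in>carrier G. \<ominus> f x) \<in> carrier RG"
      using f by (intro group_ring_memI[where S = "supp f"]) (auto simp: mem_supp)
    show "\<exists>g\<in>carrier RG. g \<oplus>\<^bsub>RG\<^esub> f = \<zero>\<^bsub>RG\<^esub>"
      by (rule bexI[OF _ m], rule group_ring_eqI)
        (use f m in \<open>auto simp: add_coeff zero_coeff R.l_neg intro!: add_closed zero_closed\<close>)
  qed (auto intro!: add_closed zero_closed group_ring_eqI simp: add_coeff zero_coeff R.a_ac)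
  show "comm_monoid RG"
  proof (rule comm_monoidI)
    show "\<one>\<^bsub>RG\<^esub> \<otimes>\<^bsub>RG\<^esub> f = f" if "f \<in> carrier RG" for f
      using that unfolding const_one[symmetric]
      by (intro group_ring_eqI mult_closed const_closed) (auto simp: const_mult_coeff)
  qed (auto intro!: mult_closed one_closed mult_assoc intro: mult_comm)
  fix f g h assume fgh: "f \<in> carrier RG" "g \<in> carrier RG" "h \<in> carrier RG"
  show "(f \<oplus>\<^bsub>RG\<^esub> g) \<otimes>\<^bsub>RG\<^esub> h = f \<otimes>\<^bsub>RG\<^esub> h \<oplus>\<^bsub>RG\<^esub> g \<otimes>\<^bsub>RG\<^esub> h"
  proof (rule group_ring_eqI)
    fix x assume x: "x \<in> carrier G"
    define S where "S = supp f \<union> supp g"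
    have S: "finite S" "S \<subseteq> carrier G" "supp f \<subseteq> S" "supp g \<subseteq> S"
      using fgh supp_subset by (auto simp: S_def)
    have fg: "supp (f \<oplus>\<^bsub>RG\<^esub> g) \<subseteq> S"
      by (auto simp: mem_supp S_def add_coeff)
    note [simp] = subsetD[OF S(2)]
    have "((f \<oplus>\<^bsub>RG\<^esub> g) \<otimes>\<^bsub>RG\<^esub> h) x = (\<Oplus>y\<in>S. (f \<oplus>\<^bsub>RG\<^esub> g) y \<otimes> h (inv\<^bsub>G\<^esub> y \<otimes>\<^bsub>G\<^esub> x))"
      using fgh x S fg by (intro mult_coeff add_closed)
    also have "\<dots> = (\<Oplus>y\<in>S. f y \<otimes> h (inv\<^bsub>G\<^esub> y \<otimes>\<^bsub>G\<^esub> x) \<oplus> g y \<otimes> h (inv\<^bsub>G\<^esub> y \<otimes>\<^bsub>G\<^esub> x))"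
      using fgh x S by (intro R.finsum_cong' refl) (auto simp: add_coeff R.l_distr)
    also have "\<dots> = (f \<otimes>\<^bsub>RG\<^esub> h) x \<oplus> (g \<otimes>\<^bsub>RG\<^esub> h) x"
      using fgh x S by (subst R.finsum_addf) (auto simp: mult_coeff[where S = S])
    finally show "((f \<oplus>\<^bsub>RG\<^esub> g) \<otimes>\<^bsub>RG\<^esub> h) x = (f \<otimes>\<^bsub>RG\<^esub> h \<oplus>\<^bsub>RG\<^esub> g \<otimes>\<^bsub>RG\<^esub> h) x"
      using x by (simp add: add_coeff)
  qed (use fgh in \<open>auto intro!: mult_closed add_closed\<close>)
qed

lemma minus_coeff:
  assumes f: "f \<in> carrier RG" and g: "g \<in> carrier RG" and x: "x \<in> carrier G"
  shows "(f \<ominus>\<^bsub>RG\<^esub> g) x = f x \<ominus> g x"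
proof -
  interpret A: cring RG by (rule group_ring_cring)
  have "(f \<ominus>\<^bsub>RG\<^esub> g) \<oplus>\<^bsub>RG\<^esub> g = f"
    using f g by (simp add: A.minus_eq A.a_assoc A.l_neg)
  then have "f x = (f \<ominus>\<^bsub>RG\<^esub> g) x \<oplus> g x"
    using add_coeff[OF x, of "f \<ominus>\<^bsub>RG\<^esub> g" g] by simp
  moreover have "(f \<ominus>\<^bsub>RG\<^esub> g) x \<in> carrier R" "g x \<in> carrier R"
    using f g x by (auto intro!: coeff_closed)
  ultimately show ?thesis
    by (simp add: R.minus_eq R.a_assoc R.r_neg)
qed

lemma const_ring_hom: "const \<in> ring_hom R RG"
proof (rule ring_hom_memI)
  fix c d assume cd: "c \<in> carrier R" "d \<in> carrier R"
  show "const (c \<otimes> d) = const c \<otimes>\<^bsub>RG\<^esub> const d"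
    using cd by (intro group_ring_eqI const_closed mult_closed)
      (auto simp: const_mult_coeff const_closed, auto simp: const_def)
  show "const (c \<oplus> d) = const c \<oplus>\<^bsub>RG\<^esub> const d"
    using cd by (intro group_ring_eqI const_closed add_closed) (auto simp: add_coeff const_def)
qed (auto simp: const_closed const_one)


text \<open>
  Turns a congruence between coefficients into divisibility by a constant of the group ring, the
  form in which the results on powers apply.
\<close>

lemma PIdl_coeffs_const_mult:
  assumes a: "a \<in> carrier R" and d: "d \<in> carrier RG"
    and dvd: "\<And>x. x \<in> carrier G \<Longrightarrow> d x \<in> PIdl\<^bsub>R\<^esub> a"
  shows "\<exists>h\<in>carrier RG. d = const a \<otimes>\<^bsub>RG\<^esub> h"
proof -
  have "\<forall>x\<in>carrier G. \<exists>c\<in>carrier R. d x = a \<otimes> c"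
  proof
    fix x assume "x \<in> carrier G"
    then obtain c where "c \<in> carrier R" "d x = c \<otimes> a"
      using dvd by (auto simp: cgenideal_def)
    then show "\<exists>c\<in>carrier R. d x = a \<otimes> c"
      using R.m_comm[OF a] by auto
  qed
  then obtain q where q: "\<And>x. x \<in> carrier G \<Longrightarrow> q x \<in> carrier R"
    and dq: "\<And>x. x \<in> carrier G \<Longrightarrow> d x = a \<otimes> q x"
    by metis
  \<comment> \<open>A quotient of zero need not be chosen as zero; forcing it to be keeps the support finite.\<close>
  define h where "h = (\<lambda>x\<in>carrier G. if d x = \<zero> then \<zero> else q x)"
  have h: "h \<in> carrier RG"
    unfolding h_def using q d
    by (intro group_ring_memI[where S = "supp d"]) (auto simp: mem_supp)
  have "d = const a \<otimes>\<^bsub>RG\<^esub> h"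
  proof (rule group_ring_eqI)
    fix x assume x: "x \<in> carrier G"
    show "d x = (const a \<otimes>\<^bsub>RG\<^esub> h) x"
      unfolding const_mult_coeff[OF a h x] using a x dq by (simp add: h_def)
  qed (use a d h in \<open>auto intro: mult_closed const_closed\<close>)
  with h show ?thesis by blast
qed

end

section \<open>Reduction of coefficients\<close>

context comm_group_ring
begin

lemma quotient_comm_group_ring:
  assumes "ideal I R"
  shows "comm_group_ring (R Quot I) G"
  using ideal.quotient_is_cring[OF assms R.is_cring] G.comm_group_axioms
  by (simp add: comm_group_ring_def)

lemma reduce_coeffs_closed:
  assumes I: "ideal I R" and f: "f \<in> carrier RG"
  shows "reduce_coeffs R I G f \<in> carrier (group_ring (R Quot I) G)"
proof -
  interpret Q: comm_group_ring "R Quot I" G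
    using I by (rule quotient_comm_group_ring)
  interpret h: ring_hom_cring R "R Quot I" "(+>) I"
    using I R.is_cring by (rule ideal.rcos_ring_hom_cring)
  show ?thesis
    unfolding reduce_coeffs_def using f
    by (intro Q.group_ring_memI[where S = "supp f"]) (auto simp: mem_supp)
qed

text \<open>
  The support may shrink under reduction, so the convolution of the reductions is expanded over the
  support of $f$ itself.
\<close>

lemma reduce_coeffs_mult:
  assumes I: "ideal I R" and f: "f \<in> carrier RG" and g: "g \<in> carrier RG"
  shows "reduce_coeffs R I G (f \<otimes>\<^bsub>RG\<^esub> g) =
    reduce_coeffs R I G f \<otimes>\<^bsub>group_ring (R Quot I) G\<^esub> reduce_coeffs R I G g"
proof -
  interpret Q: comm_group_ring "R Quot I" G
    using I by (rule quotient_comm_group_ring)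
  interpret h: ring_hom_cring R "R Quot I" "(+>) I"
    using I R.is_cring by (rule ideal.rcos_ring_hom_cring)
  let ?red = "reduce_coeffs R I G"
  note [simp] = subsetD[OF supp_subset]
  show ?thesis
  proof (rule Q.group_ring_eqI)
    fix x assume x: "x \<in> carrier G"
    have sub: "Q.supp (?red f) \<subseteq> supp f"
      by (auto simp: mem_supp Q.mem_supp reduce_coeffs_def)
    have "?red (f \<otimes>\<^bsub>RG\<^esub> g) x = I +> (\<Oplus>y\<in>supp f. f y \<otimes> g (inv\<^bsub>G\<^esub> y \<otimes>\<^bsub>G\<^esub> x))"
      using x by (simp add: reduce_coeffs_def mult_coeff_supp)
    also have "\<dots> = (\<Oplus>\<^bsub>R Quot I\<^esub>y\<in>supp f. I +> (f y \<otimes> g (inv\<^bsub>G\<^esub> y \<otimes>\<^bsub>G\<^esub> x)))"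
      using f g x by (subst h.hom_finsum) (auto simp: o_def)
    also have "\<dots> = (\<Oplus>\<^bsub>R Quot I\<^esub>y\<in>supp f. ?red f y \<otimes>\<^bsub>R Quot I\<^esub> ?red g (inv\<^bsub>G\<^esub> y \<otimes>\<^bsub>G\<^esub> x))"
      using f g x by (intro Q.R.finsum_cong' refl) (auto simp: reduce_coeffs_def)
    also have "\<dots> = (?red f \<otimes>\<^bsub>Q.RG\<^esub> ?red g) x"
      using f g x I sub
      by (intro Q.mult_coeff[symmetric] reduce_coeffs_closed supp_subset finite_supp)
    finally show "?red (f \<otimes>\<^bsub>RG\<^esub> g) x = (?red f \<otimes>\<^bsub>Q.RG\<^esub> ?red g) x" .
  qed (use I f g in \<open>auto intro!: reduce_coeffs_closed mult_closed Q.mult_closed\<close>)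
qed

lemma reduce_coeffs_eqD:
  assumes I: "ideal I R" and f: "f \<in> carrier RG" and g: "g \<in> carrier RG"
    and eq: "reduce_coeffs R I G f = reduce_coeffs R I G g" and x: "x \<in> carrier G"
  shows "f x \<ominus> g x \<in> I"
proof -
  have "I +> f x = I +> g x"
    using fun_cong[OF eq, of x] x by (simp add: reduce_coeffs_def)
  then show ?thesis
    using R.quotient_eq_iff_same_a_r_cos[OF I] f g x by simp
qed

end

section \<open>Powers and congruences in a commutative ring\<close>

text \<open>The binomial expansion to second order; the remainder is left implicit.\<close>

lemma (in cring) nat_pow_add_expand:
  assumes y: "y \<in> carrier R" and z: "z \<in> carrier R"
  shows "\<exists>w\<in>carrier R. (y \<oplus> z) [^] Suc n =
    y [^] Suc n \<oplus> ([Suc n] \<cdot> \<one>) \<otimes> (y [^] n \<otimes> z) \<oplus> z \<otimes> z \<otimes> w"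
proof (induction n)
  case 0
  show ?case using y z by (intro bexI[of _ \<zero>]) auto
next
  case (Suc n)
  then obtain w where w: "w \<in> carrier R" and IH: "(y \<oplus> z) [^] Suc n =
      y [^] Suc n \<oplus> ([Suc n] \<cdot> \<one>) \<otimes> (y [^] n \<otimes> z) \<oplus> z \<otimes> z \<otimes> w"
    by blast
  define Y c where "Y = y [^] n" and "c = [Suc n] \<cdot> \<one>"
  have cl: "Y \<in> carrier R" "c \<in> carrier R" using y by (auto simp: Y_def c_def)
  have "(y \<oplus> z) [^] Suc (Suc n) = (Y \<otimes> y \<oplus> c \<otimes> (Y \<otimes> z) \<oplus> z \<otimes> z \<otimes> w) \<otimes> (y \<oplus> z)"
    using IH by (simp add: Y_def c_def)
  also have "\<dots> = Y \<otimes> y \<otimes> y \<oplus> (c \<oplus> \<one>) \<otimes> (Y \<otimes> y \<otimes> z) \<oplus> z \<otimes> z \<otimes> (w \<otimes> y \<oplus> c \<otimes> Y \<oplus> w \<otimes> z)"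
    using y z w cl by algebra
  also have "\<dots> = y [^] Suc (Suc n) \<oplus> ([Suc (Suc n)] \<cdot> \<one>) \<otimes> (y [^] Suc n \<otimes> z) \<oplus>
      z \<otimes> z \<otimes> (w \<otimes> y \<oplus> c \<otimes> Y \<oplus> w \<otimes> z)"
    using y by (simp add: Y_def c_def)
  finally show ?case
    using y z w cl by (intro bexI[of _ "w \<otimes> y \<oplus> c \<otimes> Y \<oplus> w \<otimes> z"]) auto
qed

text \<open>
  With $z = a^{i+1} h$, the linear term of $(y + z)^p$ gains a factor $a$ from its coefficient
  $p = a u$, and the remainder is divisible by $z^2$, hence by $a^{2i+2}$, where $2i + 2 \ge i + 2$.
\<close>

lemma (in cring) pow_cong_step:
  assumes a: "a \<in> carrier R" and u: "u \<in> carrier R" and p: "[(p::nat)] \<cdot> \<one> = a \<otimes> u" "0 < p"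
    and y: "y \<in> carrier R" and h: "h \<in> carrier R"
  shows "\<exists>h'\<in>carrier R. (y \<oplus> a [^] Suc i \<otimes> h) [^] p = y [^] p \<oplus> a [^] Suc (Suc i) \<otimes> h'"
proof -
  obtain n where n: "p = Suc n" using p(2) by (cases p) auto
  define b where "b = a [^] i"
  have b: "b \<in> carrier R" using a by (simp add: b_def)
  obtain w where w: "w \<in> carrier R" and eq: "(y \<oplus> b \<otimes> a \<otimes> h) [^] p =
      y [^] p \<oplus> ([p] \<cdot> \<one>) \<otimes> (y [^] n \<otimes> (b \<otimes> a \<otimes> h)) \<oplus> (b \<otimes> a \<otimes> h) \<otimes> (b \<otimes> a \<otimes> h) \<otimes> w"
    using nat_pow_add_expand[of y "b \<otimes> a \<otimes> h" n] y a b h unfolding n by auto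
  define Y P where "Y = y [^] n" and "P = y [^] p"
  have cl: "Y \<in> carrier R" "P \<in> carrier R" using y by (auto simp: Y_def P_def)
  let ?h = "u \<otimes> Y \<otimes> h \<oplus> b \<otimes> h \<otimes> h \<otimes> w"
  have "P \<oplus> (a \<otimes> u) \<otimes> (Y \<otimes> (b \<otimes> a \<otimes> h)) \<oplus> (b \<otimes> a \<otimes> h) \<otimes> (b \<otimes> a \<otimes> h) \<otimes> w = P \<oplus> b \<otimes> a \<otimes> a \<otimes> ?h"
    using a b h u w cl by algebra
  then have "(y \<oplus> a [^] Suc i \<otimes> h) [^] p = y [^] p \<oplus> a [^] Suc (Suc i) \<otimes> ?h"
    using eq by (simp add: b_def Y_def P_def p(1))
  moreover have "?h \<in> carrier R" using b h u w cl by simp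
  ultimately show ?thesis by blast
qed

lemma (in cring) pow_cong_iterate:
  assumes a: "a \<in> carrier R" and u: "u \<in> carrier R" and p: "[(p::nat)] \<cdot> \<one> = a \<otimes> u" "0 < p"
    and y: "y \<in> carrier R" and h: "h \<in> carrier R"
  shows "\<exists>h'\<in>carrier R. (y \<oplus> a \<otimes> h) [^] (p ^ j) = y [^] (p ^ j) \<oplus> a [^] Suc j \<otimes> h'"
proof (induction j)
  case 0
  show ?case using a y h by auto
next
  case (Suc j)
  then obtain h' where h': "h' \<in> carrier R"
    and IH: "(y \<oplus> a \<otimes> h) [^] (p ^ j) = y [^] (p ^ j) \<oplus> a [^] Suc j \<otimes> h'"
    by blast
  have split: "x [^] (p ^ Suc j) = (x [^] (p ^ j)) [^] p" if "x \<in> carrier R" for x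
    using that by (simp add: nat_pow_pow mult.commute)
  show ?case
    using pow_cong_step[OF a u p, of "y [^] (p ^ j)" h' j] y a h h' IH
    by (simp only: split m_closed a_closed nat_pow_closed)
qed

lemma (in ring) mem_idempotents:
  "e \<in> idempotents R \<longleftrightarrow> e \<in> carrier R \<and> e \<otimes> e = e"
  by (auto simp: idempotents_def numeral_2_eq_2)

lemma (in monoid) idempotent_nat_pow:
  assumes "e \<in> carrier G" "e \<otimes> e = e" "0 < n"
  shows "e [^] (n::nat) = e"
proof -
  have "e [^] Suc m = e" for m
    by (induction m) (use assms(1,2) in auto)
  then show ?thesis using assms(3) by (cases n) auto
qed

section \<open>The maximal ideal of a finite chain ring\<close>

text \<open>
  By finiteness $a^m = a^{m+d}$ for some $d > 0$, that is, $a^m (1 - a^d) = 0$. Since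
  $1 - a^d$ is outside the maximal ideal and ideals are comparable, it generates an ideal properly
  containing the maximal one, so it is a unit and $a^m = 0$.
\<close>

lemma (in finite_chain_ring) maximal_generator_nilpotent:
  assumes a: "a \<in> carrier R" and max: "maximalideal (PIdl a) R"
  shows "\<exists>n>0. a [^] (n::nat) = \<zero>"
proof -
  interpret N: maximalideal "PIdl a" R by (rule max)
  have "\<not> inj (\<lambda>n::nat. a [^] n)"
  proof
    assume "inj (\<lambda>n::nat. a [^] n)"
    then have "finite (UNIV :: nat set)"
      by (rule inj_on_finite[OF _ _ finite_carrier]) (use a in auto)
    then show False by simp
  qed
  then obtain m n where mn: "m < n" "a [^] m = a [^] (n::nat)"
    by (metis injI linorder_neqE_nat)
  define d where "d = n - m"
  have d: "n = m + d" "0 < d" using mn(1) by (auto simp: d_def)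
  define A D where "A = a [^] m" and "D = a [^] d"
  have cl: "A \<in> carrier R" "D \<in> carrier R" using a by (auto simp: A_def D_def)
  have AD: "A = A \<otimes> D"
    unfolding A_def D_def nat_pow_mult[OF a] using mn(2) d(1) by simp
  have DN: "D \<in> PIdl a"
  proof -
    obtain j where "d = Suc j" using d(2) by (cases d) auto
    then have "D = a [^] j \<otimes> a" by (simp add: D_def)
    moreover have "a [^] j \<in> carrier R" using a by simp
    ultimately show ?thesis unfolding cgenideal_def by blast
  qed
  have "A \<otimes> (\<one> \<ominus> D) = A \<ominus> A \<otimes> D" using cl by (simp add: minus_eq r_distr r_minus)
  then have kill: "A \<otimes> (\<one> \<ominus> D) = \<zero>" using AD cl by (simp add: minus_eq r_neg)
  have not_in: "\<one> \<ominus> D \<notin> PIdl a"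
  proof
    assume "\<one> \<ominus> D \<in> PIdl a"
    then have "(\<one> \<ominus> D) \<oplus> D \<in> PIdl a" using DN by (rule N.a_closed)
    moreover have "(\<one> \<ominus> D) \<oplus> D = \<one>" using cl by (simp add: minus_eq a_assoc l_neg)
    ultimately show False using N.one_imp_carrier N.I_notcarr by simp
  qed
  have J: "ideal (PIdl (\<one> \<ominus> D)) R" "\<one> \<ominus> D \<in> PIdl (\<one> \<ominus> D)"
    using cl by (auto intro: cgenideal_ideal cgenideal_self)
  then have "PIdl a \<subseteq> PIdl (\<one> \<ominus> D)"
    using ideals_chain[OF J(1) N.is_ideal] not_in by blast
  then have "PIdl (\<one> \<ominus> D) = carrier R"
    using N.I_maximal[OF J(1)] J not_in ideal.Icarr[OF J(1)] by blast
  then have "\<one> \<in> PIdl (\<one> \<ominus> D)" by simp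
  then obtain v where v: "v \<in> carrier R" "\<one> = v \<otimes> (\<one> \<ominus> D)"
    unfolding cgenideal_def by blast
  have "A = A \<otimes> (v \<otimes> (\<one> \<ominus> D))" using cl unfolding v(2)[symmetric] by simp
  also have "\<dots> = v \<otimes> (A \<otimes> (\<one> \<ominus> D))" using v(1) cl by (simp add: m_lcomm)
  also have "\<dots> = \<zero>" using kill v(1) by simp
  finally have "a [^] Suc m = \<zero>" using a by (simp add: A_def)
  then show ?thesis by blast
qed

lemma (in ring_hom_cring) hom_add_pow_nat:
  "x \<in> carrier R \<Longrightarrow> h ([(n::nat)] \<cdot> x) = [n] \<cdot>\<^bsub>S\<^esub> h x"
  by (induction n) auto

text \<open>
  The characteristic is 0 by convention when no positive multiple of 1 vanishes. In a finite ring
  the multiple by the order of the additive group vanishes, which excludes this case.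
\<close>

lemma (in cring) residue_characteristic:
  assumes fin: "finite (carrier R)" and I: "ideal I R"
  shows "0 < ring_characteristic (R Quot I)" "[ring_characteristic (R Quot I)] \<cdot> \<one> \<in> I"
proof -
  interpret h: ring_hom_cring R "R Quot I" "(+>) I"
    using I is_cring by (rule ideal.rcos_ring_hom_cring)
  let ?P = "\<lambda>n::nat. 0 < n \<and> [n] \<cdot>\<^bsub>R Quot I\<^esub> \<one>\<^bsub>R Quot I\<^esub> = \<zero>\<^bsub>R Quot I\<^esub>"
  have "[card (carrier R)] \<cdot> \<one> = \<zero>"
    using add.power_order_eq_one[OF fin one_closed] .
  then have "[card (carrier R)] \<cdot>\<^bsub>R Quot I\<^esub> \<one>\<^bsub>R Quot I\<^esub> = \<zero>\<^bsub>R Quot I\<^esub>"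
    using h.hom_add_pow_nat[of \<one> "card (carrier R)"] by simp
  then have P: "?P (card (carrier R))"
    using fin one_closed by (auto simp: card_gt_0_iff)
  then have "ring_characteristic (R Quot I) = (LEAST n. ?P n)"
    unfolding ring_characteristic_def by (intro if_P) blast
  then have char: "?P (ring_characteristic (R Quot I))"
    using LeastI[of ?P, OF P] by simp
  then show "0 < ring_characteristic (R Quot I)" by simp
  have "I +> ([ring_characteristic (R Quot I)] \<cdot> \<one>) = \<zero>\<^bsub>R Quot I\<^esub>"
    using char by (simp add: h.hom_add_pow_nat)
  then show "[ring_characteristic (R Quot I)] \<cdot> \<one> \<in> I"
    by (intro ideal.rcos_const_imp_mem[OF I]) (simp_all only: FactRing_def ring.simps, simp)
qed

section \<open>Lifting idempotents\<close>

theorem mainTheorem4: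
  fixes R :: "('a, 'm) ring_scheme"
    and G :: "('g, 'n) monoid_scheme"
    and N :: "'a set" and a :: 'a and k p :: nat
    and F :: "'a set ring"
  assumes "finite_chain_ring R"
    and "maximalideal N R"
    and "a \<in> carrier R"
    and "N = PIdl\<^bsub>R\<^esub> a"
    and "k = nilpotency_index R a"
    and "F = R Quot (PIdl\<^bsub>R\<^esub> a)"
    and "p = ring_characteristic F"
    and "comm_group G"
  shows "idempotents (group_ring R G) =
    {f [^]\<^bsub>group_ring R G\<^esub> r | f r.
       r = p ^ (k - 1) \<and> f \<in> carrier (group_ring R G) \<and>
       reduce_coeffs R (PIdl\<^bsub>R\<^esub> a) G f \<in> idempotents (group_ring F G)}"
proof -
  interpret finite_chain_ring R by (rule assms(1))
  interpret comm_group_ring R G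
    using assms(8) is_cring by (simp add: comm_group_ring_def)
  interpret A: cring RG by (rule group_ring_cring)
  interpret const: ring_hom_cring R RG const
    by unfold_locales (rule const_ring_hom)
  note a = assms(3)
  define I where "I = PIdl\<^bsub>R\<^esub> a"
  have I: "ideal I R" unfolding I_def using a by (rule cgenideal_ideal)
  have F: "F = R Quot I" using assms(6) by (simp add: I_def)
  interpret Q: comm_group_ring "R Quot I" G using I by (rule quotient_comm_group_ring)
  interpret B: cring Q.RG by (rule Q.group_ring_cring)
  let ?red = "reduce_coeffs R I G" and ?r = "p ^ (k - 1)"

  have "\<exists>n>0. a [^]\<^bsub>R\<^esub> (n::nat) = \<zero>\<^bsub>R\<^esub>"
    using maximal_generator_nilpotent a assms(2,4) by simp
  then have k: "0 < k" "a [^]\<^bsub>R\<^esub> k = \<zero>\<^bsub>R\<^esub>"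
    using LeastI_ex[of "\<lambda>n. 0 < n \<and> a [^]\<^bsub>R\<^esub> (n::nat) = \<zero>\<^bsub>R\<^esub>"] assms(5)
    by (auto simp: nilpotency_index_def)
  have p: "0 < p" "[p] \<cdot>\<^bsub>R\<^esub> \<one>\<^bsub>R\<^esub> \<in> I"
    using residue_characteristic[OF finite_carrier I] assms(7) F by simp_all
  then obtain u where u: "u \<in> carrier R" "[p] \<cdot>\<^bsub>R\<^esub> \<one>\<^bsub>R\<^esub> = a \<otimes>\<^bsub>R\<^esub> u"
    using a m_comm by (auto simp: I_def cgenideal_def)
  have p_RG: "[p] \<cdot>\<^bsub>RG\<^esub> \<one>\<^bsub>RG\<^esub> = const a \<otimes>\<^bsub>RG\<^esub> const u"
    using const.hom_add_pow_nat[of "\<one>\<^bsub>R\<^esub>" p] u a by simp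
  have const_pow: "const a [^]\<^bsub>RG\<^esub> n = const (a [^]\<^bsub>R\<^esub> n)" for n :: nat
    by (induction n) (use a in auto)

  have lift: "f [^]\<^bsub>RG\<^esub> ?r \<in> idempotents RG"
    if f: "f \<in> carrier RG" and red: "?red f \<in> idempotents Q.RG" for f
  proof -
    let ?s = "f \<otimes>\<^bsub>RG\<^esub> f"
    have "?red f \<otimes>\<^bsub>Q.RG\<^esub> ?red f = ?red f"
      using red by (simp add: B.mem_idempotents)
    then have "?red ?s = ?red f"
      using reduce_coeffs_mult[OF I f f] by simp
    then have "?s x \<ominus>\<^bsub>R\<^esub> f x \<in> I" if "x \<in> carrier G" for x
      using reduce_coeffs_eqD[OF I _ f _ that] f by simp
    moreover have "(?s \<ominus>\<^bsub>RG\<^esub> f) x = ?s x \<ominus>\<^bsub>R\<^esub> f x" if "x \<in> carrier G" for x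
      using minus_coeff[OF _ f that] f by simp
    ultimately obtain h where h: "h \<in> carrier RG" "?s \<ominus>\<^bsub>RG\<^esub> f = const a \<otimes>\<^bsub>RG\<^esub> h"
      using PIdl_coeffs_const_mult[OF a, of "?s \<ominus>\<^bsub>RG\<^esub> f"] f unfolding I_def by auto
    have "?s = f \<oplus>\<^bsub>RG\<^esub> (?s \<ominus>\<^bsub>RG\<^esub> f)" using f A.m_closed[OF f f] by algebra
    then have s: "?s = f \<oplus>\<^bsub>RG\<^esub> const a \<otimes>\<^bsub>RG\<^esub> h" using h(2) by simp
    obtain h' where h': "h' \<in> carrier RG"
      "(f \<oplus>\<^bsub>RG\<^esub> const a \<otimes>\<^bsub>RG\<^esub> h) [^]\<^bsub>RG\<^esub> ?r = f [^]\<^bsub>RG\<^esub> ?r \<oplus>\<^bsub>RG\<^esub> const a [^]\<^bsub>RG\<^esub> Suc (k - 1) \<otimes>\<^bsub>RG\<^esub> h'"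
      using A.pow_cong_iterate[OF _ _ p_RG p(1) f h(1), of "k - 1"] a u(1) by auto
    have "const a [^]\<^bsub>RG\<^esub> Suc (k - 1) = \<zero>\<^bsub>RG\<^esub>"
      unfolding const_pow using k by simp
    then have "?s [^]\<^bsub>RG\<^esub> ?r = f [^]\<^bsub>RG\<^esub> ?r"
      using s h' f by simp
    moreover have "?s [^]\<^bsub>RG\<^esub> ?r = f [^]\<^bsub>RG\<^esub> ?r \<otimes>\<^bsub>RG\<^esub> f [^]\<^bsub>RG\<^esub> ?r"
      using f by (simp add: A.nat_pow_distrib)
    ultimately show ?thesis
      using f by (simp add: A.mem_idempotents)
  qed
  have fixed: "e [^]\<^bsub>RG\<^esub> ?r = e" "e \<in> carrier RG" "?red e \<in> idempotents Q.RG"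
    if "e \<in> idempotents RG" for e
  proof -
    have e: "e \<in> carrier RG" and ee: "e \<otimes>\<^bsub>RG\<^esub> e = e"
      using that by (simp_all add: A.mem_idempotents)
    show "e \<in> carrier RG" by (fact e)
    show "e [^]\<^bsub>RG\<^esub> ?r = e"
      using A.idempotent_nat_pow[OF e ee] p(1) by simp
    show "?red e \<in> idempotents Q.RG"
      using reduce_coeffs_mult[OF I e e] reduce_coeffs_closed[OF I e] ee
      by (simp add: B.mem_idempotents)
  qed
  show ?thesis
    unfolding F I_def[symmetric]
  proof (intro equalityI subsetI)
    fix e assume "e \<in> idempotents RG"
    from fixed[OF this] show "e \<in> {f [^]\<^bsub>RG\<^esub> r | f r.
        r = ?r \<and> f \<in> carrier RG \<and> ?red f \<in> idempotents Q.RG}"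
      by (intro CollectI exI[of _ e] exI[of _ ?r]) simp
  qed (use lift in blast)
qed

end
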